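(* Let $n$ and $b$ be positive integers satisfying $b>\log(128\,b\log n)$. Then there exists a transmission array $\mathcal T$ for $n$ stations and $b$ channels, of length $\mathcal O(\frac{n}{b}\log n\log(b\log n))$, such that the algorithm Wake-Up$(\mathcal T)$ wakes up the network within $\mathcal O(\frac{k}{b}\log n\log(b\log n))$ time steps (counted from the first spontaneous activation), for every $k\le n$ and every activation pattern with at most $k$ spontaneously activated stations.
   Context: Model: $n$ stations with distinct names in $\{1,\dots,n\}$ and $b$ channels numbered $1,\dots,b$. Time is divided into synchronous global time steps. In each step each active station may transmit on any subset of channels; all stations listen on all channels. A message on channel $\beta$ in a step is heard by everybody iff exactly one station transmits on $\beta$ in that step; otherwise nothing is heard (no collision detection). Initially all stations are passive; an activation pattern specifies at most $k$ stations and arbitrary time steps $\sigma_u$ at which each such station $u$ becomes active spontaneously. An active station $u$ perceives global time step $t$ as its local round $t-\sigma_u$. The network is woken up at the first time step at which some channel carries a transmission by exactly one station. A transmission array of length $\ell$ is an array of bits $T(u,\beta,j)$ for stations $u$, channels $\beta$ and positions $1\le j\le\ell$. Algorithm Wake-Up$(\mathcal T)$: each activated station $u$, in its local round $j\le\ell$, transmits on channel $\beta$ iff $T(u,\beta,j)=1$, and stops once a message has been heard. The array depends only on $n$ and $b$; $k$ is unknown to the stations. Logarithms are binary.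
   Formalization: Both bounds are proved as O(1 + (n/b) log n log(b log n)) and O(1 + (k/b) log n log(b log n)); the added 1 is needed because the expressions tend to 0 for fixed n, k and large b (and are 0 for n = 1), while at least one position and one step are required. *)

theory Defs
  imports Complex_Main
begin

text \<open>A transmission array: T u beta j is the bit for station u, channel beta,
  position j (only 1 \<le> u \<le> n, 1 \<le> beta \<le> b, 1 \<le> j \<le> ell are relevant).\<close>
type_synonym tarray = "nat \<Rightarrow> nat \<Rightarrow> nat \<Rightarrow> bool"

text \<open>Station u, activated spontaneously at global step sigma u, transmits on channel
  beta at global step t under Wake-Up(T) (before anything has been heard) iff its local
  round j = t - sigma u satisfies 1 \<le> j \<le> ell and T u beta j.\<close>
definition transmits :: "tarray \<Rightarrow> nat \<Rightarrow> (nat \<Rightarrow> nat) \<Rightarrow> nat \<Rightarrow> nat \<Rightarrow> nat \<Rightarrow> bool" where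
  "transmits T ell \<sigma> u \<beta> t \<longleftrightarrow>
     \<sigma> u \<le> t \<and> 1 \<le> t - \<sigma> u \<and> t - \<sigma> u \<le> ell \<and> T u \<beta> (t - \<sigma> u)"

definition heard_at :: "tarray \<Rightarrow> nat \<Rightarrow> nat \<Rightarrow> nat set \<Rightarrow> (nat \<Rightarrow> nat) \<Rightarrow> nat \<Rightarrow> bool" where
  "heard_at T ell b A \<sigma> t \<longleftrightarrow>
     (\<exists>\<beta>\<in>{1..b}. card {u \<in> A. transmits T ell \<sigma> u \<beta> t} = 1)"

definition wakes_within :: "tarray \<Rightarrow> nat \<Rightarrow> nat \<Rightarrow> nat set \<Rightarrow> (nat \<Rightarrow> nat) \<Rightarrow> real \<Rightarrow> bool" where
  "wakes_within T ell b A \<sigma> d \<longleftrightarrow>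
     (\<exists>t. heard_at T ell b A \<sigma> t \<and> Min (\<sigma> ` A) \<le> t \<and> real (t - Min (\<sigma> ` A)) \<le> d)"

end

theory Submission
  imports Defs "HOL-Probability.Product_PMF"
begin

text \<open>
  The array is random, with independent bits. A station in its local round \<open>j\<close> has weight
  \<open>min 1 (R / j)\<close>, and on channel \<open>\<beta>\<close> it transmits with this weight divided by
  \<open>2 ^ Suc ((\<beta> - 1) mod M)\<close>, where \<open>M\<close> is about \<open>log (b log n)\<close>: each of \<open>M\<close> scales is served by
  \<open>g = b div M\<close> channels. The parameters \<open>R = K div g + 1\<close> and \<open>m = g div K + 1\<close>, where \<open>K\<close> is a
  large multiple of \<open>log n\<close>, satisfy \<open>g R \<ge> K m / 2\<close> whether or not \<open>K\<close> exceeds \<open>g\<close>. Counting time from the first activation, take the least \<open>i\<close> such that at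
  most \<open>m 2^i\<close> stations are active at time \<open>R 2^i\<close>. If \<open>i > 0\<close>, more than \<open>m 2^(i-1)\<close> stations are
  active already at time \<open>R 2^(i-1)\<close>, so that the total weight is at least \<open>1/2\<close> throughout
  \<open>(R 2^(i-1), R 2^i]\<close>; since each station contributes at most \<open>R (i + 1)\<close> to the sum of all weights
  up to time \<open>R 2^i\<close>, the total weight is at most \<open>4 m (i + 1)\<close> in half of these rounds. In such a
  round one of the scales brings the expected number of transmitters into \<open>[1/4, 1/2]\<close>, and each of
  its \<open>g\<close> channels succeeds with probability at least \<open>1/8\<close>. Altogether there are
  \<open>\<Omega>(g R 2^i) = \<Omega>(m 2^i log n)\<close> independent trials, which beats the union bound over the
  \<open>n^O(m 2^i)\<close> activation patterns of at most \<open>m 2^i\<close> stations.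
\<close>

subsection \<open>Independent bits\<close>

text \<open>The product rule for countable sets suffices: cutting \<open>A\<close> and
  \<open>B\<close> down to the supports, which are countable, changes no probability.\<close>

lemma prob_pair_pmf_Times:
  "measure_pmf.prob (pair_pmf M N) (A \<times> B) = measure_pmf.prob M A * measure_pmf.prob N B"
proof -
  have "measure_pmf.prob (pair_pmf M N) (A \<times> B)
      = measure_pmf.prob (pair_pmf M N) ((A \<inter> set_pmf M) \<times> (B \<inter> set_pmf N))"
    by (intro measure_prob_cong_0) (auto simp: pmf_pair pmf_eq_0_set_pmf)
  also have "\<dots> = measure_pmf.prob M (A \<inter> set_pmf M) * measure_pmf.prob N (B \<inter> set_pmf N)"
    by (intro measure_pmf_prob_product) auto
  finally show ?thesis
    by (simp add: measure_Int_set_pmf)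
qed

text \<open>Sampling on \<open>\<Omega>\<close> amounts to merging independent samples on
  \<open>D\<close> and \<open>\<Omega> - D\<close> by \<open>h\<close>. Each event sees only one of
  the two, so its preimage under \<open>h\<close> is a product set.\<close>

lemma prob_Pi_pmf_conj:
  assumes fin: "finite \<Omega>" and D: "D \<subseteq> \<Omega>"
    and E: "\<And>f g. (\<And>x. x \<in> D \<Longrightarrow> f x = g x) \<Longrightarrow> E f \<longleftrightarrow> E g"
    and F: "\<And>f g. (\<And>x. x \<in> \<Omega> - D \<Longrightarrow> f x = g x) \<Longrightarrow> F f \<longleftrightarrow> F g"
  shows "measure_pmf.prob (Pi_pmf \<Omega> d p) {f. E f \<and> F f}
       = measure_pmf.prob (Pi_pmf \<Omega> d p) {f. E f} * measure_pmf.prob (Pi_pmf \<Omega> d p) {f. F f}"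
proof -
  define h where "h = (\<lambda>(f, g) x. if x \<in> D then f x else g x :: 'b)"
  define P Q where "P = Pi_pmf D d p" and "Q = Pi_pmf (\<Omega> - D) d p"
  have "Pi_pmf (D \<union> (\<Omega> - D)) d p = map_pmf h (pair_pmf P Q)"
    unfolding h_def P_def Q_def using fin D
    by (intro Pi_pmf_union) (auto intro: finite_subset)
  also have "D \<union> (\<Omega> - D) = \<Omega>"
    using D by blast
  finally have eq: "Pi_pmf \<Omega> d p = map_pmf h (pair_pmf P Q)" .
  have hE: "E (h (f, g)) \<longleftrightarrow> E f" for f g
    by (rule E) (auto simp: h_def)
  have hF: "F (h (f, g)) \<longleftrightarrow> F g" for f g
    by (rule F) (auto simp: h_def)
  have "h -` {f. E f \<and> F f} = {f. E f} \<times> {g. F g}" "h -` {f. E f} = {f. E f} \<times> UNIV"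
    "h -` {f. F f} = UNIV \<times> {g. F g}"
    using hE hF by auto
  then show ?thesis
    by (simp add: eq prob_pair_pmf_Times)
qed

lemma prob_Pi_pmf_all_le_power:
  fixes q :: real
  assumes fin: "finite \<Omega>" "finite J"
    and D: "\<And>j. j \<in> J \<Longrightarrow> D j \<subseteq> \<Omega>"
    and disj: "\<And>i j. i \<in> J \<Longrightarrow> j \<in> J \<Longrightarrow> i \<noteq> j \<Longrightarrow> D i \<inter> D j = {}"
    and E: "\<And>j f g. j \<in> J \<Longrightarrow> (\<And>x. x \<in> D j \<Longrightarrow> f x = g x) \<Longrightarrow> E j f \<longleftrightarrow> E j g"
    and q: "\<And>j. j \<in> J \<Longrightarrow> measure_pmf.prob (Pi_pmf \<Omega> d p) {f. E j f} \<le> q"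
  shows "measure_pmf.prob (Pi_pmf \<Omega> d p) {f. \<forall>j\<in>J. E j f} \<le> q ^ card J"
  using fin(2) D disj E q
proof (induction J rule: finite_induct)
  case empty
  then show ?case by simp
next
  case (insert k J)
  have "measure_pmf.prob (Pi_pmf \<Omega> d p) {f. \<forall>j\<in>insert k J. E j f}
      = measure_pmf.prob (Pi_pmf \<Omega> d p) {f. E k f \<and> (\<forall>j\<in>J. E j f)}"
    by simp
  also have "\<dots> = measure_pmf.prob (Pi_pmf \<Omega> d p) {f. E k f}
      * measure_pmf.prob (Pi_pmf \<Omega> d p) {f. \<forall>j\<in>J. E j f}"
  proof (rule prob_Pi_pmf_conj[OF fin(1), of "D k"])
    show "D k \<subseteq> \<Omega>" using insert.prems(1) by blast
    show "E k f \<longleftrightarrow> E k g" if "\<And>x. x \<in> D k \<Longrightarrow> f x = g x" for f g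
      using insert.prems(3)[of k f g] that by blast
    show "(\<forall>j\<in>J. E j f) \<longleftrightarrow> (\<forall>j\<in>J. E j g)" if *: "\<And>x. x \<in> \<Omega> - D k \<Longrightarrow> f x = g x" for f g
    proof (intro ball_cong refl)
      fix j assume j: "j \<in> J"
      then have "D j \<inter> D k = {}" "D j \<subseteq> \<Omega>"
        using insert.hyps insert.prems(1)[of j] insert.prems(2)[of j k] by auto
      then show "E j f \<longleftrightarrow> E j g"
        using insert.prems(3)[of j f g] j * by blast
    qed
  qed
  also have "\<dots> \<le> q * q ^ card J"
  proof (rule mult_mono)
    show "measure_pmf.prob (Pi_pmf \<Omega> d p) {f. E k f} \<le> q"
      using insert.prems(4) by blast
    then show "0 \<le> q"
      by (rule order_trans[rotated]) auto
    show "measure_pmf.prob (Pi_pmf \<Omega> d p) {f. \<forall>j\<in>J. E j f} \<le> q ^ card J"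
    proof (rule insert.IH)
      show "\<And>j f g. j \<in> J \<Longrightarrow> (\<And>x. x \<in> D j \<Longrightarrow> f x = g x) \<Longrightarrow> E j f \<longleftrightarrow> E j g"
        using insert.prems(3) by blast
    qed (use insert.prems(1,2,4) in auto)
  qed auto
  finally show ?case
    using insert.hyps by simp
qed

text \<open>Split by the coordinate \<open>x\<close> that is the only true one. By Weierstrass's
  product inequality all others are false with probability at least 1 minus the sum of the
  \<open>p y\<close>, hence at least 1/2. Summing \<open>p x / 2\<close> gives 1/8.\<close>

lemma prob_exactly_one_ge:
  fixes p :: "'a \<Rightarrow> real"
  assumes fin: "finite \<Omega>" and X: "X \<subseteq> \<Omega>" and p: "\<And>x. x \<in> X \<Longrightarrow> p x \<in> {0..1}"
    and s: "(\<Sum>x\<in>X. p x) \<in> {1/4..1/2}"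
  shows "measure_pmf.prob (Pi_pmf \<Omega> False (\<lambda>x. bernoulli_pmf (p x))) {f. card {x \<in> X. f x} = 1} \<ge> 1/8"
proof -
  let ?P = "measure_pmf.prob (Pi_pmf \<Omega> False (\<lambda>x. bernoulli_pmf (p x)))"
  \<comment> \<open>The values allowed at \<open>y\<close> when \<open>x\<close> is the only true
    coordinate of \<open>X\<close>. The event becomes a disjoint union of boxes, whose probabilities
    factor.\<close>
  define B where "B x y = (if y = x then {True} else if y \<in> X then {False} else UNIV)" for x y
  have finX: "finite X" using fin X finite_subset by auto
  have eq: "{f. card {x \<in> X. f x} = 1} = (\<Union>x\<in>X. Pi \<Omega> (B x))"
  proof (rule set_eqI)
    fix f :: "'a \<Rightarrow> bool"
    have "f \<in> {f. card {x \<in> X. f x} = 1} \<longleftrightarrow> (\<exists>x. {x \<in> X. f x} = {x})"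
      by (simp add: card_1_singleton_iff)
    also have "\<dots> \<longleftrightarrow> (\<exists>x\<in>X. f x \<and> (\<forall>y\<in>X. y \<noteq> x \<longrightarrow> \<not> f y))"
      by blast
    also have "\<dots> \<longleftrightarrow> (\<exists>x\<in>X. f \<in> Pi \<Omega> (B x))"
      using X by (intro bex_cong refl) (fastforce simp: Pi_def B_def split: if_splits)
    finally show "f \<in> {f. card {x \<in> X. f x} = 1} \<longleftrightarrow> f \<in> (\<Union>x\<in>X. Pi \<Omega> (B x))"
      by simp
  qed
  have "disjoint_family_on (\<lambda>x. Pi \<Omega> (B x)) X"
    unfolding disjoint_family_on_def
  proof (intro ballI impI)
    fix x y assume "x \<in> X" "y \<in> X" "x \<noteq> y"
    then have "f x" "\<not> f x" if "f \<in> Pi \<Omega> (B x) \<inter> Pi \<Omega> (B y)" for f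
      using that X by (auto simp: B_def Pi_def split: if_splits)
    then show "Pi \<Omega> (B x) \<inter> Pi \<Omega> (B y) = {}" by blast
  qed
  then have "?P {f. card {x \<in> X. f x} = 1} = (\<Sum>x\<in>X. ?P (Pi \<Omega> (B x)))"
    unfolding eq using finX by (intro measure_pmf.finite_measure_finite_Union) auto
  also have "\<dots> \<ge> (\<Sum>x\<in>X. p x * (1/2))"
  proof (rule sum_mono)
    fix x assume x: "x \<in> X"
    have pr: "measure_pmf.prob (bernoulli_pmf (p y)) (B x y) = (if y = x then p x else 1 - p y)"
      if "y \<in> X" for y
      using p[OF that] that by (auto simp: B_def measure_pmf_single)
    have "?P (Pi \<Omega> (B x)) = (\<Prod>y\<in>\<Omega>. measure_pmf.prob (bernoulli_pmf (p y)) (B x y))"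
      using fin by (rule measure_Pi_pmf_Pi)
    also have "\<dots> = (\<Prod>y\<in>X. measure_pmf.prob (bernoulli_pmf (p y)) (B x y))"
      using fin X x by (intro prod.mono_neutral_right) (auto simp: B_def)
    also have "\<dots> = p x * (\<Prod>y\<in>X - {x}. 1 - p y)"
      using finX x by (auto simp: prod.remove[of X x] pr intro!: prod.cong)
    finally have eq': "?P (Pi \<Omega> (B x)) = p x * (\<Prod>y\<in>X - {x}. 1 - p y)" .
    have "(\<Prod>y\<in>X - {x}. 1 - p y) \<ge> 1 - (\<Sum>y\<in>X - {x}. p y)"
      using p by (intro Weierstrass_prod_ineq) auto
    moreover have "(\<Sum>y\<in>X - {x}. p y) \<le> (\<Sum>y\<in>X. p y)"
      using p finX by (intro sum_mono2) auto
    ultimately have "1/2 \<le> (\<Prod>y\<in>X - {x}. 1 - p y)"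
      using s by simp
    then have "p x * (1/2) \<le> p x * (\<Prod>y\<in>X - {x}. 1 - p y)"
      using p[OF x] by (intro mult_left_mono) auto
    with eq' show "p x * (1/2) \<le> ?P (Pi \<Omega> (B x))"
      by simp
  qed
  moreover have "(\<Sum>x\<in>X. p x * (1/2)) \<ge> 1/8"
    using s by (simp add: sum_divide_distrib[symmetric])
  ultimately show ?thesis by linarith
qed

text \<open>Such a \<open>P\<close> is the set of entries of a list of length exactly
  \<open>q\<close>: enumerate it and pad by repeating the first element, which exists because
  \<open>P\<close> is nonempty.\<close>

lemma card_small_subsets_le:
  assumes "finite Y"
  shows "card {P. P \<subseteq> Y \<and> P \<noteq> {} \<and> card P \<le> q} \<le> card Y ^ q"
proof -
  have "{P. P \<subseteq> Y \<and> P \<noteq> {} \<and> card P \<le> q} \<subseteq> set ` {xs. set xs \<subseteq> Y \<and> length xs = q}"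
  proof
    fix P assume "P \<in> {P. P \<subseteq> Y \<and> P \<noteq> {} \<and> card P \<le> q}"
    then have P: "P \<subseteq> Y" "P \<noteq> {}" "card P \<le> q"
      by auto
    obtain ys where ys: "set ys = P" "distinct ys"
      using finite_distinct_list finite_subset[OF P(1) assms] by blast
    define xs where "xs = ys @ replicate (q - length ys) (hd ys)"
    have "length ys = card P" "ys \<noteq> []"
      using ys P distinct_card by fastforce+
    then have "set xs = P" "length xs = q"
      using ys P by (auto simp: xs_def set_replicate_conv_if)
    then show "P \<in> set ` {xs. set xs \<subseteq> Y \<and> length xs = q}"
      using P by blast
  qed
  then have "card {P. P \<subseteq> Y \<and> P \<noteq> {} \<and> card P \<le> q} \<le> card (set ` {xs. set xs \<subseteq> Y \<and> length xs = q})"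
    using assms by (intro card_mono finite_imageI finite_lists_length_eq)
  also have "\<dots> \<le> card Y ^ q"
    using card_image_le[OF finite_lists_length_eq[OF assms]] card_lists_length_eq[OF assms] by metis
  finally show ?thesis .
qed

subsection \<open>The total weight of an activation pattern\<close>

text \<open>Harmonic decay balances two needs: the sum over all rounds grows only logarithmically
  (\<open>sum_weight_le\<close>), yet the weight stays at least \<open>1 / 2 ^ i\<close> up to round
  \<open>R * 2 ^ i\<close> (\<open>weight_ge\<close>).\<close>

definition weight :: "nat \<Rightarrow> nat \<Rightarrow> real" where
  "weight R j = min 1 (real R / real j)"

lemma weight_bounds: "weight R j \<in> {0..1}"
  by (simp add: weight_def)

text \<open>The first \<open>R\<close> rounds contribute at most \<open>R\<close>, and so does every
  later dyadic block, having \<open>R * 2 ^ i\<close> terms of size at most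
  \<open>1 / 2 ^ i\<close>.\<close>

lemma sum_weight_le: "(\<Sum>j=1..R * 2 ^ i. weight R j) \<le> real R * (real i + 1)"
proof (induction i)
  case 0
  have "(\<Sum>j=1..R. weight R j) \<le> (\<Sum>j=1..R. 1)"
    by (intro sum_mono) (simp add: weight_def)
  then show ?case by simp
next
  case (Suc i)
  have "(\<Sum>j=1..R * 2 ^ Suc i. weight R j)
      = (\<Sum>j=1..R * 2 ^ i. weight R j) + (\<Sum>j=R * 2 ^ i + 1..R * 2 ^ i + R * 2 ^ i. weight R j)"
    using sum.ub_add_nat[of 1 "R * 2 ^ i" "weight R" "R * 2 ^ i"] by (simp add: mult_2 distrib_left)
  also have "(\<Sum>j=R * 2 ^ i + 1..R * 2 ^ i + R * 2 ^ i. weight R j)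
      \<le> (\<Sum>j=R * 2 ^ i + 1..R * 2 ^ i + R * 2 ^ i. 1 / 2 ^ i)"
  proof (rule sum_mono)
    fix j assume j: "j \<in> {R * 2 ^ i + 1..R * 2 ^ i + R * 2 ^ i}"
    have "weight R j \<le> real R / real j"
      by (simp add: weight_def)
    also have "\<dots> \<le> 1 / 2 ^ i"
    proof -
      have "real (R * 2 ^ i) \<le> real j" using j by (intro of_nat_mono) simp
      then show ?thesis using j by (simp add: field_simps)
    qed
    finally show "weight R j \<le> 1 / 2 ^ i" .
  qed
  also have "\<dots> = real R"
    by simp
  finally show ?case using Suc.IH by (simp add: algebra_simps)
qed

text \<open>The inequality is strict because a station is in local round 0 in the step of its
  activation, while array positions start at 1.\<close>

definition load :: "nat \<Rightarrow> (nat \<times> nat) set \<Rightarrow> nat \<Rightarrow> real" where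
  "load R P t = (\<Sum>x\<in>{x \<in> P. snd x < t}. weight R (t - snd x))"

text \<open>
  A pair \<open>(u, s)\<close> stands for station \<open>u\<close> being activated \<open>s\<close> steps after the first activation. The
  last clause is what the argument uses of the minimality of \<open>i\<close>.
\<close>
definition patterns :: "nat \<Rightarrow> nat \<Rightarrow> nat \<Rightarrow> nat \<Rightarrow> (nat \<times> nat) set set" where
  "patterns n R m i = {P. P \<subseteq> {1..n} \<times> {0..R * 2 ^ i} \<and> inj_on fst P \<and> P \<noteq> {} \<and> card P \<le> m * 2 ^ i \<and>
     (if i = 0 then \<exists>u. (u, 0) \<in> P else m * 2 ^ (i - 1) < card {x \<in> P. snd x \<le> R * 2 ^ (i - 1)})}"

lemma sum_shifted_weight_le:
  "(\<Sum>t=1..N. if s < t then weight R (t - s) else 0) \<le> (\<Sum>j=1..N. weight R j)"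
proof -
  have "(\<Sum>t=1..N. if s < t then weight R (t - s) else 0) = (\<Sum>t\<in>{t \<in> {1..N}. s < t}. weight R (t - s))"
    by (rule sum.inter_filter[symmetric]) simp
  also have "\<dots> = (\<Sum>j\<in>(\<lambda>t. t - s) ` {t \<in> {1..N}. s < t}. weight R j)"
    by (subst sum.reindex) (auto simp: inj_on_def)
  also have "\<dots> \<le> (\<Sum>j=1..N. weight R j)"
    using weight_bounds by (intro sum_mono2) auto
  finally show ?thesis .
qed

lemma sum_load_le:
  assumes "finite P"
  shows "(\<Sum>t=1..R * 2 ^ i. load R P t) \<le> real (card P) * (real R * (real i + 1))"
proof -
  have "(\<Sum>t=1..R * 2 ^ i. load R P t)
      = (\<Sum>t=1..R * 2 ^ i. \<Sum>x\<in>P. if snd x < t then weight R (t - snd x) else 0)"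
    using assms by (simp add: load_def sum.inter_filter)
  also have "\<dots> = (\<Sum>x\<in>P. \<Sum>t=1..R * 2 ^ i. if snd x < t then weight R (t - snd x) else 0)"
    by (rule sum.swap)
  also have "\<dots> \<le> (\<Sum>x\<in>P. real R * (real i + 1))"
    by (intro sum_mono order_trans[OF sum_shifted_weight_le sum_weight_le])
  finally show ?thesis by simp
qed

lemma load_nonneg: "load R P t \<ge> 0"
  unfolding load_def using weight_bounds by (intro sum_nonneg) auto

lemma load_le_card:
  assumes "finite P"
  shows "load R P t \<le> card P"
proof -
  have "load R P t \<le> (\<Sum>x\<in>{x \<in> P. snd x < t}. 1)"
    unfolding load_def using weight_bounds by (intro sum_mono) auto
  also have "\<dots> \<le> card P"
    using assms by (simp add: card_mono)
  finally show ?thesis .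
qed

lemma weight_ge:
  assumes "1 \<le> j" "j \<le> R * 2 ^ i"
  shows "weight R j \<ge> 1 / 2 ^ i"
proof -
  have "real j \<le> real (R * 2 ^ i)"
    using assms(2) by (simp only: of_nat_le_iff)
  then have "1 / 2 ^ i \<le> real R / real j"
    using assms(1) by (simp add: divide_simps)
  moreover have "1 / 2 ^ i \<le> (1::real)"
    by simp
  ultimately show ?thesis
    by (simp add: weight_def)
qed

lemma load_ge:
  assumes "finite P" "r < t" "t \<le> R * 2 ^ i"
  shows "load R P t \<ge> card {x \<in> P. snd x \<le> r} / 2 ^ i"
proof -
  have "real (card {x \<in> P. snd x \<le> r}) / 2 ^ i = (\<Sum>x\<in>{x \<in> P. snd x \<le> r}. 1 / 2 ^ i)"
    by simp
  also have "\<dots> \<le> (\<Sum>x\<in>{x \<in> P. snd x \<le> r}. weight R (t - snd x))"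
    using assms by (intro sum_mono weight_ge) auto
  also have "\<dots> \<le> load R P t"
    unfolding load_def using assms weight_bounds by (intro sum_mono2) auto
  finally show ?thesis .
qed

text \<open>If \<open>i = 0\<close>, the first station alone has weight 1 up to time
  \<open>R\<close> and there are at most \<open>m\<close> stations, so every time is good. If
  \<open>i > 0\<close>, Markov's inequality discards at most half of the second half of the window;
  a quarter of the window remains.\<close>

lemma patterns_good_times:
  assumes P: "P \<in> patterns n R m i" and m: "1 \<le> m" and R: "1 \<le> R"
  obtains G where "G \<subseteq> {1..R * 2 ^ i}" "R * 2 ^ i \<le> 4 * card G"
    "\<And>t. t \<in> G \<Longrightarrow> load R P t \<in> {1/2..4 * real m * (real i + 1)}"
proof -
  have fin: "finite P"
    using P finite_subset[of P "{1..n} \<times> {0..R * 2 ^ i}"] by (auto simp: patterns_def)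
  have card: "card P \<le> m * 2 ^ i"
    using P by (simp add: patterns_def)
  show thesis
  proof (cases i)
    case 0
    have "load R P t \<in> {1/2..4 * real m * (real i + 1)}" if t: "t \<in> {1..R}" for t
    proof -
      obtain u where "(u, 0) \<in> P"
        using P 0 by (auto simp: patterns_def)
      then have "card {x \<in> P. snd x \<le> 0} \<ge> 1"
        using fin by (auto simp: Suc_le_eq card_gt_0_iff)
      moreover have "load R P t \<ge> card {x \<in> P. snd x \<le> 0} / 2 ^ 0"
        using t fin by (intro load_ge) auto
      moreover have "load R P t \<le> m"
        using load_le_card[OF fin, of R t] card 0 by simp
      ultimately show ?thesis
        using m 0 by auto
    qed
    then show ?thesis
      using that[of "{1..R}"] 0 by auto
  next
    case (Suc i')
    define r where "r = R * 2 ^ i'"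
    define W where "W = {r<..2 * r}"
    \<comment> \<open>The factor 4 is chosen so that the upper bound
      \<open>m * 2 ^ i * R * (i + 1)\<close> on the sum of all loads equals \<open>r / 2\<close>
      times \<open>bound\<close>; hence at most \<open>r / 2\<close> times are overloaded.\<close>
    define bound where "bound = 4 * real m * (real i + 1)"
    define H where "H = {t \<in> W. load R P t > bound}"
    have len: "R * 2 ^ i = 2 * r" by (simp add: Suc r_def)
    have low: "load R P t \<ge> 1/2" if "t \<in> W" for t
    proof -
      have "m * 2 ^ i' < card {x \<in> P. snd x \<le> r}"
        using P Suc by (simp add: patterns_def r_def)
      then have "real (m * 2 ^ i') < card {x \<in> P. snd x \<le> r}"
        by (simp only: of_nat_less_iff)
      then have "real m / 2 \<le> card {x \<in> P. snd x \<le> r} / 2 ^ i"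
        by (simp add: Suc field_simps)
      also have "\<dots> \<le> load R P t"
        using that fin len by (intro load_ge) (auto simp: W_def)
      finally show ?thesis using m by linarith
    qed
    have "card H * bound = (\<Sum>t\<in>H. bound)"
      by simp
    also have "\<dots> \<le> (\<Sum>t\<in>H. load R P t)"
      by (intro sum_mono) (auto simp: H_def)
    also have "\<dots> \<le> (\<Sum>t=1..R * 2 ^ i. load R P t)"
      using load_nonneg by (intro sum_mono2) (auto simp: H_def W_def len)
    also have "\<dots> \<le> real (card P) * (real R * (real i + 1))"
      by (rule sum_load_le[OF fin])
    also have "\<dots> \<le> real (m * 2 ^ i) * (real R * (real i + 1))"
      using card by (intro mult_right_mono) (auto simp del: of_nat_mult)
    also have "\<dots> = (real r / 2) * bound"
      by (simp add: bound_def r_def Suc)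
    finally have "card H * bound \<le> (real r / 2) * bound" .
    moreover have "bound > 0"
      using m by (simp add: bound_def)
    ultimately have "real (card H) \<le> real r / 2"
      by (rule mult_right_le_imp_le)
    moreover have "card (W - H) + card H = r"
    proof -
      have "H \<subseteq> W" "finite W" "card W = r"
        by (auto simp: H_def W_def)
      then show ?thesis
        using card_Diff_subset[of H W] card_mono[of W H] finite_subset[of H W] by simp
    qed
    ultimately have "R * 2 ^ i \<le> 4 * card (W - H)"
      by (simp add: len)
    then show ?thesis
      using low that[of "W - H"] by (force simp: W_def H_def len bound_def)
  qed
qed

text \<open>The least \<open>s\<close> with \<open>x \<le> 2 ^ s\<close> also satisfies
  \<open>2 ^ s \<le> 2 * x\<close>: by minimality if \<open>s > 0\<close>, and by
  \<open>1/2 \<le> x\<close> if \<open>s = 0\<close>.\<close>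

lemma ex_scale:
  fixes x :: real
  assumes "1/2 \<le> x" "x \<le> 2 ^ (M - 1)" "1 \<le> M"
  shows "\<exists>s<M. x / 2 ^ Suc s \<in> {1/4..1/2}"
proof -
  define s where "s = (LEAST s. x \<le> 2 ^ s)"
  have le: "x \<le> 2 ^ s" and "s \<le> M - 1"
    unfolding s_def using assms(2) by (auto intro: LeastI Least_le)
  have "2 ^ s \<le> 2 * x"
  proof (cases s)
    case 0
    then show ?thesis using assms by simp
  next
    case (Suc s')
    then have "\<not> x \<le> 2 ^ s'"
      using not_less_Least[of s' "\<lambda>s. x \<le> 2 ^ s"] by (simp add: s_def)
    then show ?thesis by (simp add: Suc)
  qed
  then show ?thesis
    using le \<open>s \<le> M - 1\<close> assms(3) by (intro exI[of _ s]) (auto simp: field_simps)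
qed

text \<open>Each of the \<open>b div M\<close> complete blocks of \<open>M\<close> consecutive
  channels contains one channel of scale \<open>s\<close>.\<close>

lemma card_channels_ge:
  fixes s M b :: nat
  assumes "s < M"
  shows "b div M \<le> card {\<beta> \<in> {1..b}. (\<beta> - 1) mod M = s}"
proof -
  have "(\<lambda>q. q * M + s + 1) ` {..<b div M} \<subseteq> {\<beta> \<in> {1..b}. (\<beta> - 1) mod M = s}"
  proof safe
    fix q assume "q < b div M"
    then have "Suc q * M \<le> b div M * M"
      by (intro mult_right_mono) auto
    also have "\<dots> \<le> b"
      by (rule div_times_less_eq_dividend)
    finally show "q * M + s + 1 \<in> {1..b}"
      using assms by simp
  qed (use assms in simp)
  then have "card ((\<lambda>q. q * M + s + 1) ` {..<b div M}) \<le> card {\<beta> \<in> {1..b}. (\<beta> - 1) mod M = s}"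
    by (intro card_mono) auto
  moreover have "card ((\<lambda>q. q * M + s + 1) ` {..<b div M}) = b div M"
    using assms by (subst card_image) (auto simp: inj_on_def)
  ultimately show ?thesis by simp
qed

subsection \<open>The random array\<close>

definition bit_prob :: "nat \<Rightarrow> nat \<Rightarrow> nat \<times> nat \<times> nat \<Rightarrow> real" where
  "bit_prob R M = (\<lambda>(u, \<beta>, j). weight R j / 2 ^ Suc ((\<beta> - 1) mod M))"

definition array_pmf :: "nat \<Rightarrow> nat \<Rightarrow> nat \<Rightarrow> nat \<Rightarrow> nat \<Rightarrow> (nat \<times> nat \<times> nat \<Rightarrow> bool) pmf" where
  "array_pmf n b ell R M =
     Pi_pmf ({1..n} \<times> {1..b} \<times> {1..ell}) False (\<lambda>x. bernoulli_pmf (bit_prob R M x))"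

text \<open>Time is relative to the first activation and only \<open>P\<close> enters, so the union
  bound runs over finitely many patterns although activation times are arbitrary.\<close>

definition silent :: "(nat \<times> nat \<times> nat \<Rightarrow> bool) \<Rightarrow> nat \<Rightarrow> (nat \<times> nat) set \<Rightarrow> nat \<Rightarrow> bool" where
  "silent f b P d \<longleftrightarrow>
     (\<forall>t\<in>{1..d}. \<forall>\<beta>\<in>{1..b}. card {x \<in> P. snd x < t \<and> f (fst x, \<beta>, t - snd x)} \<noteq> 1)"

lemma bit_prob_bounds: "bit_prob R M x \<in> {0..1}"
proof -
  obtain u \<beta> j where x: "x = (u, \<beta>, j)" by (cases x)
  have "weight R j \<le> 1" by (simp add: weight_def)
  also have "1 \<le> (2::real) ^ Suc ((\<beta> - 1) mod M)" by (rule one_le_power) simp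
  finally show ?thesis
    using weight_bounds[of R j] by (simp add: bit_prob_def x)
qed

lemma prob_silent_le:
  assumes P: "P \<in> patterns n R m i" and m: "1 \<le> m" and R: "1 \<le> R" and M: "1 \<le> M"
    and ell: "R * 2 ^ i \<le> ell" and bound: "4 * real m * (real i + 1) \<le> 2 ^ (M - 1)"
    and Q: "4 * Q \<le> (b div M) * (R * 2 ^ i)"
  shows "measure_pmf.prob (array_pmf n b ell R M) {f. silent f b P (R * 2 ^ i)} \<le> (7/8) ^ Q"
proof -
  define \<Omega> where "\<Omega> = {1..n} \<times> {1..b} \<times> {1..ell}"
  let ?\<mu> = "Pi_pmf \<Omega> False (\<lambda>x. bernoulli_pmf (bit_prob R M x))"
  obtain G where G: "G \<subseteq> {1..R * 2 ^ i}" "R * 2 ^ i \<le> 4 * card G"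
    and load: "\<And>t. t \<in> G \<Longrightarrow> load R P t \<in> {1/2..4 * real m * (real i + 1)}"
    using patterns_good_times[OF P m R] by blast
  have Psub: "P \<subseteq> {1..n} \<times> {0..R * 2 ^ i}" and inj: "inj_on fst P"
    using P by (auto simp: patterns_def)
  have finP: "finite P"
    using Psub by (rule finite_subset) auto
  have finG: "finite G"
    using G(1) by (rule finite_subset) auto
  \<comment> \<open>The scale depends on the load of \<open>P\<close> alone and not on the random
    bits, so the set \<open>J\<close> of trials below is fixed before sampling.\<close>
  have "\<forall>t\<in>G. \<exists>s<M. load R P t / 2 ^ Suc s \<in> {1/4..1/2}"
    using load bound M by (intro ballI ex_scale) (fastforce intro: order_trans)+
  then obtain s where s: "\<And>t. t \<in> G \<Longrightarrow> s t < M \<and> load R P t / 2 ^ Suc (s t) \<in> {1/4..1/2}"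
    by metis
  define C where "C t = {\<beta> \<in> {1..b}. (\<beta> - 1) mod M = s t}" for t
  define J where "J = Sigma G C"
  \<comment> \<open>\<open>D (t, \<beta>)\<close> collects the bits that decide who transmits on
    \<open>\<beta>\<close> at time \<open>t\<close>.\<close>
  define D :: "nat \<times> nat \<Rightarrow> (nat \<times> nat \<times> nat) set" where "D = (\<lambda>(t, \<beta>). (\<lambda>x. (fst x, \<beta>, t - snd x)) ` {x \<in> P. snd x < t})"
  define E where "E = (\<lambda>j f. card {x \<in> D j. f x} \<noteq> 1)"
  have finJ: "finite J"
    using finG by (auto simp: J_def C_def)
  have "(b div M) * card G = (\<Sum>t\<in>G. b div M)"
    by simp
  also have "\<dots> \<le> (\<Sum>t\<in>G. card (C t))"
    unfolding C_def using s by (intro sum_mono card_channels_ge) auto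
  also have "\<dots> = card J"
    using finG by (simp add: J_def card_SigmaI C_def)
  finally have "(b div M) * card G \<le> card J" .
  then have "4 * ((b div M) * card G) \<le> 4 * card J"
    by simp
  moreover have "(b div M) * (R * 2 ^ i) \<le> (b div M) * (4 * card G)"
    using G(2) by (intro mult_left_mono) auto
  ultimately have QJ: "Q \<le> card J"
    using Q by linarith
  have inj': "inj_on (\<lambda>x. (fst x, \<beta>, t - snd x)) {x \<in> P. snd x < t}" for \<beta> t
    by (auto simp: inj_on_def prod_eq_iff)
  have D_sub: "D j \<subseteq> \<Omega>" if "j \<in> J" for j
    using that G(1) Psub ell by (fastforce simp: J_def C_def D_def \<Omega>_def)
  \<comment> \<open>A bit is read at one time only: as \<open>fst\<close> is injective on
    \<open>P\<close>, a station has a single activation time, so its round determines the global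
    time.\<close>
  have disj: "D j \<inter> D k = {}" if "j \<in> J" "k \<in> J" "j \<noteq> k" for j k
  proof (rule ccontr)
    assume "D j \<inter> D k \<noteq> {}"
    moreover obtain t \<beta> t' \<beta>' where jk: "j = (t, \<beta>)" "k = (t', \<beta>')"
      by (cases j, cases k)
    ultimately obtain x y where xy: "x \<in> P" "y \<in> P" "snd x < t" "snd y < t'" "fst x = fst y" "\<beta> = \<beta>'"
      "t - snd x = t' - snd y"
      by (auto simp: D_def)
    then have "x = y"
      using inj by (auto simp: inj_on_def)
    then show False
      using xy jk that by simp
  qed
  have le: "measure_pmf.prob ?\<mu> {f. \<forall>j\<in>J. E j f} \<le> (7/8) ^ card J"
  proof (rule prob_Pi_pmf_all_le_power[OF _ finJ D_sub disj])
    show "finite \<Omega>" by (simp add: \<Omega>_def)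
    show "E j f \<longleftrightarrow> E j g" if "\<And>x. x \<in> D j \<Longrightarrow> f x = g x" for j f g
    proof -
      have "{x \<in> D j. f x} = {x \<in> D j. g x}" using that by auto
      then show ?thesis by (simp add: E_def)
    qed
  next
    fix j assume j: "j \<in> J"
    obtain t \<beta> where tb: "j = (t, \<beta>)" by (cases j)
    have t: "t \<in> G" and \<beta>: "(\<beta> - 1) mod M = s t"
      using j by (auto simp: J_def C_def tb)
    have "(\<Sum>x\<in>D j. bit_prob R M x) = (\<Sum>x\<in>{x \<in> P. snd x < t}. weight R (t - snd x) / 2 ^ Suc (s t))"
      by (simp only: D_def tb case_prod_conv sum.reindex[OF inj'] comp_def bit_prob_def \<beta>)
    also have "\<dots> = load R P t / 2 ^ Suc (s t)"
      by (simp only: load_def sum_divide_distrib)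
    finally have "(\<Sum>x\<in>D j. bit_prob R M x) \<in> {1/4..1/2}"
      using s[OF t] by simp
    then have "measure_pmf.prob ?\<mu> {f. card {x \<in> D j. f x} = 1} \<ge> 1/8"
      using D_sub[OF j] bit_prob_bounds by (intro prob_exactly_one_ge) (auto simp: \<Omega>_def)
    moreover have "{f. E j f} = UNIV - {f. card {x \<in> D j. f x} = 1}"
      by (auto simp: E_def)
    ultimately show "measure_pmf.prob ?\<mu> {f. E j f} \<le> 7/8"
      using measure_pmf.prob_compl[of "{f. card {x \<in> D j. f x} = 1}" ?\<mu>] by simp
  qed
  have sub: "{f. silent f b P (R * 2 ^ i)} \<subseteq> {f. \<forall>j\<in>J. E j f}"
  proof (intro subsetI CollectI ballI)
    fix f j assume f: "f \<in> {f. silent f b P (R * 2 ^ i)}" and j: "j \<in> J"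
    obtain t \<beta> where tb: "j = (t, \<beta>)" by (cases j)
    have "{x \<in> D j. f x} = (\<lambda>x. (fst x, \<beta>, t - snd x)) ` {x \<in> P. snd x < t \<and> f (fst x, \<beta>, t - snd x)}"
      by (auto simp: D_def tb)
    also have "card \<dots> = card {x \<in> P. snd x < t \<and> f (fst x, \<beta>, t - snd x)}"
      by (intro card_image inj_on_subset[OF inj']) auto
    finally show "E j f"
      using f j G(1) by (auto simp: E_def silent_def tb J_def C_def)
  qed
  have "measure_pmf.prob ?\<mu> {f. silent f b P (R * 2 ^ i)} \<le> (7/8) ^ card J"
    using measure_pmf.finite_measure_mono[OF sub, of ?\<mu>] le by simp
  also have "\<dots> \<le> (7/8) ^ Q"
    using QJ by (intro power_decreasing) auto
  finally show ?thesis
    by (simp add: array_pmf_def \<Omega>_def)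
qed

text \<open>Union bound over windows and patterns: window \<open>i\<close> contains a silent pattern
  with probability at most \<open>(1/2) ^ Suc i\<close>, and these bounds sum to less than
  1.\<close>

lemma ex_array_without_silence:
  fixes b L M I :: nat
  defines "K \<equiv> 768 * L" and "g \<equiv> b div M"
  defines "R \<equiv> K div g + 1" and "m \<equiv> g div K + 1"
  assumes n: "2 \<le> n" "n \<le> 2 ^ L" "L \<le> n" and M: "1 \<le> M" "M \<le> b"
    and I: "2 ^ I \<le> 2 * n" and bound: "4 * real m * (real I + 1) \<le> 2 ^ (M - 1)"
  shows "\<exists>f. \<forall>i\<le>I. \<forall>P\<in>patterns n R m i. \<not> silent f b P (R * 2 ^ i)"
proof -
  define ell where "ell = R * 2 ^ I"
  let ?\<mu> = "array_pmf n b ell R M"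
  define S where "S i P = {f. silent f b P (R * 2 ^ i)}" for i P
  have g: "1 \<le> g"
    using M by (simp add: g_def div_greater_zero_iff Suc_le_eq)
  have L: "1 \<le> L"
    using n(1,2) by (cases L) auto
  \<comment> \<open>The \<open>+ 1\<close> in \<open>R\<close> and \<open>m\<close> compensates for
    rounding down: \<open>K < g * R\<close>, while
    \<open>K * (g div K) \<le> g \<le> g * R\<close>.\<close>
  have Km: "K * m \<le> 2 * (g * R)"
  proof -
    have "K * (g div K) \<le> g"
      by simp
    moreover have "K < g * R"
      using g dividend_less_times_div[of g K] by (simp add: R_def distrib_left add.commute)
    moreover have "g \<le> g * R"
      by (simp add: R_def)
    moreover have "K * m = K + K * (g div K)"
      by (simp add: m_def)
    ultimately show ?thesis
      by linarith
  qed
  have fin: "finite (patterns n R m i)" for i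
    by (rule finite_subset[of _ "Pow ({1..n} \<times> {0..R * 2 ^ i})"]) (auto simp: patterns_def)
  have pat: "(\<Sum>P\<in>patterns n R m i. measure_pmf.prob ?\<mu> (S i P)) \<le> (1/2) ^ Suc i" if i: "i \<le> I" for i
  proof -
    define e where "e = m * 2 ^ i"
    define Y where "Y = n * (R * 2 ^ i + 1)"
    \<comment> \<open>\<open>96 * L * e\<close> is an eighth of \<open>K * m * 2 ^ i\<close>: a
      factor 2 is lost in \<open>Km\<close> and a factor 4 because only a quarter of the times need
      be good. This fixes 768 in \<open>K\<close>.\<close>
    have prob: "measure_pmf.prob ?\<mu> (S i P) \<le> (7/8) ^ (96 * L * e)" if "P \<in> patterns n R m i" for P
      unfolding S_def
    proof (rule prob_silent_le[OF that])
      show "4 * (96 * L * e) \<le> b div M * (R * 2 ^ i)"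
        using mult_le_mono1[OF Km, of "2 ^ i"] by (simp add: K_def g_def e_def mult_ac)
      have "4 * real m * (real i + 1) \<le> 4 * real m * (real I + 1)"
        using i by (intro mult_left_mono) auto
      then show "4 * real m * (real i + 1) \<le> 2 ^ (M - 1)"
        using bound by linarith
      show "R * 2 ^ i \<le> ell"
        unfolding ell_def using i by (intro mult_le_mono2 power_increasing) auto
      show "1 \<le> m" "1 \<le> R"
        by (simp_all add: m_def R_def)
    qed (rule M)
    have "patterns n R m i \<subseteq> {P. P \<subseteq> {1..n} \<times> {0..R * 2 ^ i} \<and> P \<noteq> {} \<and> card P \<le> e}"
      unfolding patterns_def e_def by blast
    moreover have "finite {P. P \<subseteq> {1..n} \<times> {0..R * 2 ^ i} \<and> P \<noteq> {} \<and> card P \<le> e}"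
      by (rule finite_subset[of _ "Pow ({1..n} \<times> {0..R * 2 ^ i})"]) (blast, simp)
    ultimately have "card (patterns n R m i) \<le> card {P. P \<subseteq> {1..n} \<times> {0..R * 2 ^ i} \<and> P \<noteq> {} \<and> card P \<le> e}"
      by (intro card_mono)
    also have "\<dots> \<le> card ({1..n} \<times> {0..R * 2 ^ i}) ^ e"
      by (rule card_small_subsets_le) auto
    also have "\<dots> = Y ^ e"
      by (simp add: card_cartesian_product Y_def)
    finally have card: "card (patterns n R m i) \<le> Y ^ e" .
    \<comment> \<open>\<open>Y\<close> counts the possible pairs of station and activation time. It
      is cubic in \<open>n\<close> up to a constant, which \<open>2 ^ 13 \<le> n ^ 13\<close>
      absorbs.\<close>
    have "4 * Y \<le> n ^ 16"
    proof -
      have "R \<le> 769 * n"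
        using div_le_dividend[of K g] n(1,3) unfolding R_def K_def by linarith
      moreover have "(2::nat) ^ i \<le> 2 * n"
        using i I by (intro order_trans[OF power_increasing[of i I]]) auto
      ultimately have "R * 2 ^ i \<le> 769 * n * (2 * n)"
        by (rule mult_mono) auto
      moreover have "1 \<le> n * n"
        using n(1) by simp
      ultimately have "R * 2 ^ i + 1 \<le> 1539 * (n * n)"
        by linarith
      then have "4 * Y \<le> 4 * (n * (1539 * (n * n)))"
        unfolding Y_def by (intro mult_left_mono) auto
      also have "\<dots> \<le> 2 ^ 13 * n ^ 3"
        by (simp add: power3_eq_cube)
      also have "\<dots> \<le> n ^ 13 * n ^ 3"
        using n(1) by (intro mult_right_mono power_mono) auto
      finally show ?thesis by (simp flip: power_add)
    qed
    then have "real (4 * Y) \<le> real (n ^ 16)"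
      by (simp only: of_nat_le_iff)
    then have Y: "4 * real Y \<le> real n ^ 16"
      by simp
    \<comment> \<open>Since \<open>(7/8) ^ 6 \<le> 1/2\<close>, the factor 96 = 6 * 16 matches the
      exponent 16 in the bound on \<open>Y\<close>.\<close>
    have "(7/8 :: real) ^ (96 * L) = ((7/8) ^ 6) ^ (16 * L)"
      by (simp flip: power_mult)
    also have "\<dots> \<le> (1/2) ^ (16 * L)"
      by (intro power_mono) (simp_all add: power_divide)
    also have "\<dots> = 1 / (2 ^ L) ^ 16"
      by (simp add: power_divide mult.commute flip: power_mult)
    also have "\<dots> \<le> 1 / real n ^ 16"
    proof -
      have "real n \<le> real (2 ^ L)"
        using n(2) by (simp only: of_nat_le_iff)
      then have "real n \<le> 2 ^ L"
        by simp
      then show ?thesis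
        using n(1) by (intro divide_left_mono power_mono mult_pos_pos) auto
    qed
    finally have q: "(7/8 :: real) ^ (96 * L) \<le> 1 / real n ^ 16" .
    have "(\<Sum>P\<in>patterns n R m i. measure_pmf.prob ?\<mu> (S i P)) \<le> card (patterns n R m i) * (7/8) ^ (96 * L * e)"
      using prob by (intro sum_bounded_above) auto
    also have "\<dots> \<le> real (Y ^ e) * (7/8) ^ (96 * L * e)"
      using card by (intro mult_right_mono) (auto simp del: of_nat_power)
    also have "\<dots> = (real Y * (7/8) ^ (96 * L)) ^ e"
      by (simp add: power_mult power_mult_distrib)
    also have "\<dots> \<le> (1/2) ^ e"
    proof (intro power_mono)
      have "real Y * (7/8) ^ (96 * L) \<le> real Y * (1 / real n ^ 16)"
        using q by (intro mult_left_mono) auto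
      also have "\<dots> \<le> 1/2"
        using Y n(1) by (simp add: field_simps)
      finally show "real Y * (7/8) ^ (96 * L) \<le> 1/2" .
    qed auto
    also have "\<dots> \<le> (1/2) ^ Suc i"
    proof (intro power_decreasing)
      have "Suc i \<le> 2 ^ i"
        by (simp add: Suc_le_eq)
      also have "\<dots> \<le> e"
        by (simp add: e_def m_def)
      finally show "Suc i \<le> e" .
    qed auto
    finally show ?thesis .
  qed
  have "measure_pmf.prob ?\<mu> (\<Union>i\<in>{..I}. \<Union>P\<in>patterns n R m i. S i P)
      \<le> (\<Sum>i\<le>I. measure_pmf.prob ?\<mu> (\<Union>P\<in>patterns n R m i. S i P))"
    by (intro measure_pmf.finite_measure_subadditive_finite) auto
  also have "\<dots> \<le> (\<Sum>i\<le>I. \<Sum>P\<in>patterns n R m i. measure_pmf.prob ?\<mu> (S i P))"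
    using fin by (intro sum_mono measure_pmf.finite_measure_subadditive_finite) auto
  also have "\<dots> \<le> (\<Sum>i\<le>I. (1/2) ^ Suc i)"
    using pat by (intro sum_mono) auto
  also have "\<dots> = 1 - (1/2) ^ Suc I"
    by (induction I) auto
  finally have "measure_pmf.prob ?\<mu> (\<Union>i\<in>{..I}. \<Union>P\<in>patterns n R m i. S i P) < 1"
    by (rule order.strict_trans1) simp
  then have "(\<Union>i\<in>{..I}. \<Union>P\<in>patterns n R m i. S i P) \<noteq> UNIV"
    by auto
  then show ?thesis
    by (fastforce simp: S_def)
qed

subsection \<open>Waking up the network\<close>

lemma wakes_within_if_not_silent:
  assumes f: "\<And>i P. i \<le> I \<Longrightarrow> P \<in> patterns n R m i \<Longrightarrow> \<not> silent f b P (R * 2 ^ i)"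
    and I: "n \<le> m * 2 ^ I" and A: "A \<subseteq> {1..n}" "A \<noteq> {}"
  shows "\<exists>i\<le>I. (i = 0 \<or> m * 2 ^ (i - 1) < card A) \<and>
           wakes_within (\<lambda>u \<beta> j. f (u, \<beta>, j)) (R * 2 ^ I) b A \<sigma> (real (R * 2 ^ i))"
proof -
  define t0 where "t0 = Min (\<sigma> ` A)"
  define B where "B d = {u \<in> A. \<sigma> u - t0 \<le> d}" for d
  define pair where "pair u = (u, \<sigma> u - t0)" for u
  \<comment> \<open>\<open>I\<close> qualifies, since there are at most
    \<open>n \<le> m * 2 ^ I\<close> stations. Minimality gives \<open>early\<close>, which serves
    both membership in \<open>patterns\<close> and the bound on the waking time.\<close>
  define i where "i = (LEAST i. card (B (R * 2 ^ i)) \<le> m * 2 ^ i)"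
  define P where "P = pair ` B (R * 2 ^ i)"
  have finA: "finite A"
    using A(1) by (rule finite_subset) auto
  have finB: "finite (B d)" for d
    using finA by (auto simp: B_def)
  have cardB: "card (B d) \<le> card A" for d
    using finA by (auto simp: B_def intro: card_mono)
  have t0: "t0 \<le> \<sigma> u" if "u \<in> A" for u
    using that finA by (auto simp: t0_def)
  obtain u0 where u0: "u0 \<in> A" "\<sigma> u0 = t0"
  proof -
    have "Min (\<sigma> ` A) \<in> \<sigma> ` A"
      using finA A(2) by (intro Min_in) auto
    then show thesis
      using that by (auto simp: t0_def)
  qed
  have inj: "inj_on pair X" for X
    by (auto simp: pair_def inj_on_def)
  have "card A \<le> n"
    using card_mono[OF _ A(1)] by simp
  then have ex: "card (B (R * 2 ^ I)) \<le> m * 2 ^ I"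
    using cardB I by (meson order_trans)
  have i: "i \<le> I" "card (B (R * 2 ^ i)) \<le> m * 2 ^ i"
    unfolding i_def using ex by (auto intro: Least_le LeastI)
  have early: "m * 2 ^ (i - 1) < card (B (R * 2 ^ (i - 1)))" if "i \<noteq> 0"
    using not_less_Least[of "i - 1" "\<lambda>i. card (B (R * 2 ^ i)) \<le> m * 2 ^ i"] that
    by (simp add: i_def)
  have "P \<in> patterns n R m i"
    unfolding patterns_def
  proof (intro CollectI conjI)
    show "P \<subseteq> {1..n} \<times> {0..R * 2 ^ i}"
      using A(1) by (auto simp: P_def B_def pair_def)
    show "inj_on fst P"
      by (auto simp: inj_on_def P_def pair_def)
    have u0P: "(u0, 0) \<in> P"
      using u0 by (force simp: P_def B_def pair_def)
    then show "P \<noteq> {}" by blast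
    show "card P \<le> m * 2 ^ i"
      using i(2) by (simp add: P_def card_image[OF inj])
    show "if i = 0 then \<exists>u. (u, 0) \<in> P else m * 2 ^ (i - 1) < card {x \<in> P. snd x \<le> R * 2 ^ (i - 1)}"
    proof (cases "i = 0")
      case True
      then show ?thesis using u0P by auto
    next
      case False
      have "d \<le> R * 2 ^ i" if "d \<le> R * 2 ^ (i - 1)" for d
        using that by (rule order_trans) (intro mult_le_mono2 power_increasing, auto)
      then have "{x \<in> P. snd x \<le> R * 2 ^ (i - 1)} = pair ` B (R * 2 ^ (i - 1))"
        unfolding P_def B_def pair_def by force
      then show ?thesis
        using early False by (simp add: card_image[OF inj])
    qed
  qed
  then have "\<not> silent f b P (R * 2 ^ i)"
    using f i(1) by blast
  then obtain t \<beta> where t: "t \<in> {1..R * 2 ^ i}" and \<beta>: "\<beta> \<in> {1..b}"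
    and one: "card {x \<in> P. snd x < t \<and> f (fst x, \<beta>, t - snd x)} = 1"
    by (auto simp: silent_def)
  have "R * 2 ^ i \<le> R * 2 ^ I"
    using i(1) by (intro mult_left_mono power_increasing) auto
  moreover have tR: "t \<le> R * 2 ^ i" "1 \<le> t"
    using t by simp_all
  ultimately have tI: "t \<le> R * 2 ^ I"
    by linarith
  have tr: "transmits (\<lambda>u \<beta> j. f (u, \<beta>, j)) (R * 2 ^ I) \<sigma> u \<beta> (t0 + t)
      \<longleftrightarrow> \<sigma> u - t0 < t \<and> f (u, \<beta>, t - (\<sigma> u - t0))" if "u \<in> A" for u
  proof -
    have "t0 + t - \<sigma> u = t - (\<sigma> u - t0)"
      using t0[OF that] by linarith
    then show ?thesis
      using t0[OF that] tI tR(2) by (auto simp: transmits_def)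
  qed
  \<comment> \<open>Stations of \<open>A\<close> missing from \<open>P\<close> are activated after
    \<open>R * 2 ^ i\<close>, hence after \<open>t\<close>, and cannot disturb the
    transmission.\<close>
  have "{x \<in> P. snd x < t \<and> f (fst x, \<beta>, t - snd x)}
      = pair ` {u \<in> A. transmits (\<lambda>u \<beta> j. f (u, \<beta>, j)) (R * 2 ^ I) \<sigma> u \<beta> (t0 + t)}"
    using tR(1) by (force simp: P_def B_def pair_def tr)
  then have "card {u \<in> A. transmits (\<lambda>u \<beta> j. f (u, \<beta>, j)) (R * 2 ^ I) \<sigma> u \<beta> (t0 + t)} = 1"
    using one by (simp add: card_image[OF inj])
  then have "wakes_within (\<lambda>u \<beta> j. f (u, \<beta>, j)) (R * 2 ^ I) b A \<sigma> (real (R * 2 ^ i))"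
    unfolding wakes_within_def heard_at_def using \<beta> tR(1)
    by (intro exI[of _ "t0 + t"]) (auto simp flip: t0_def simp del: of_nat_mult of_nat_power)
  moreover have "i = 0 \<or> m * 2 ^ (i - 1) < card A"
    using early cardB less_le_trans by blast
  ultimately show ?thesis
    using i(1) by blast
qed

text \<open>For \<open>i > 0\<close> the hypothesis gives \<open>2 ^ i < 2 * k / m\<close>, so only
  \<open>R / m\<close> matters; \<open>R * g \<le> K + g \<le> 2 * K * m\<close> bounds it by
  \<open>2 * K / g\<close>, whichever of \<open>K\<close> and \<open>g\<close> is larger. For
  \<open>i = 0\<close> the summand 1 absorbs the rounding in \<open>R\<close>.\<close>

lemma wake_up_time_le:
  fixes g K k i :: nat
  defines "R \<equiv> K div g + 1" and "m \<equiv> g div K + 1"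
  assumes gK: "1 \<le> g" "1 \<le> K" and k: "1 \<le> k" and i: "i = 0 \<or> m * 2 ^ (i - 1) < k"
  shows "real (R * 2 ^ i) \<le> 4 * real k * (real K / real g) + 1"
proof (cases i)
  case 0
  have "real R \<le> real K / real g + 1"
    using of_nat_div_le_of_nat[of K g] by (simp add: R_def)
  also have "real K / real g \<le> 4 * real k * (real K / real g)"
    using k by (intro mult_right_mono[of 1 "4 * real k", simplified]) auto
  finally show ?thesis
    using 0 by simp
next
  case (Suc i')
  have "R * g \<le> K + g"
    by (simp add: R_def distrib_right)
  also have "\<dots> \<le> 2 * K * m"
    using gK(2) dividend_less_times_div[of K g] by (simp add: m_def distrib_left)
  finally have Rg: "R * g \<le> 2 * K * m" .
  have "R * 2 ^ i * g * m = 2 * (R * g) * (m * 2 ^ i')"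
    by (simp add: Suc)
  also have "\<dots> \<le> 2 * (2 * K * m) * k"
    using mult_le_mono[of "2 * (R * g)" "2 * (2 * K * m)" "m * 2 ^ i'" k] Rg i by (simp add: Suc)
  finally have "m * (R * 2 ^ i * g) \<le> m * (4 * k * K)"
    by (simp add: algebra_simps)
  moreover have "0 < m"
    by (simp add: m_def)
  ultimately have "R * 2 ^ i * g \<le> 4 * k * K"
    by (simp only: nat_mult_le_cancel1)
  then have "real (R * 2 ^ i * g) \<le> real (4 * k * K)"
    by (simp only: of_nat_le_iff)
  then show ?thesis
    using gK(1) by (simp add: field_simps)
qed

lemma ex_wake_up_array:
  fixes n b :: nat
  assumes n: "2 \<le> n" and b: "1 \<le> b" and hyp: "real b > log 2 (128 * real b * log 2 (real n))"
  defines "x \<equiv> log 2 (real n) * log 2 (real b * log 2 (real n)) / real b"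
  shows "\<exists>T ell. real ell \<le> 49152 * (real n * x + 1) \<and>
           (\<forall>k A \<sigma>. A \<subseteq> {1..n} \<longrightarrow> A \<noteq> {} \<longrightarrow> card A \<le> k \<longrightarrow>
              wakes_within T ell b A \<sigma> (49152 * (real k * x + 1)))"
proof -
  define l where "l = log 2 (real n)"
  define lb where "lb = log 2 (real b * l)"
  have l1: "1 \<le> l"
    using n by (simp add: l_def le_log_iff)
  have bl: "real b \<le> real b * l"
    using l1 b by simp
  have "log 2 (128 * real b * l) = 7 + log 2 (real b * l)"
    using l1 b log_mult[of 2 128 "real b * l"] log2_of_power_eq[of 128 7] by (simp add: mult.assoc)
  then have b_gt: "7 + lb < real b"
    using hyp by (simp add: l_def lb_def)
  \<comment> \<open>Bootstrapping: \<open>0 \<le> lb\<close> turns \<open>b_gt\<close> into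
    \<open>8 \<le> b\<close>, which in turn yields \<open>3 \<le> lb\<close>.\<close>
  have "0 \<le> lb"
    unfolding lb_def using mult_mono[of 1 "real b" 1 l] b l1 by (subst zero_le_log_cancel_iff) auto
  then have "real 7 < real b"
    using b_gt by simp
  then have "8 \<le> b"
    by (simp only: of_nat_less_iff)
  then have "8 \<le> real b * l"
    using bl by linarith
  then have "log 2 8 \<le> lb"
    unfolding lb_def by (subst log_le_cancel_iff) auto
  then have lb3: "3 \<le> lb"
    using log2_of_power_eq[of 8 3] by simp
  \<comment> \<open>\<open>M\<close> must be large enough for \<open>2 ^ (M - 1)\<close> to dominate
    every admissible load, and at most \<open>b\<close> so that every scale has a channel. The
    latter is where \<open>b_gt\<close> enters.\<close>
  define M where "M = nat \<lfloor>6 + lb\<rfloor> + 1"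
  define L where "L = nat \<lceil>l\<rceil>"
  define K g where "K = 768 * L" and "g = b div M"
  define R m where "R = K div g + 1" and "m = g div K + 1"
  define I where "I = (LEAST I. n \<le> m * 2 ^ I)"
  have M: "5 + lb < real (M - 1)" "real M \<le> 7 + lb" "1 \<le> M"
    using lb3 by (auto simp: M_def, linarith+)
  have Mb: "M \<le> b"
    using M(2) b_gt by linarith
  have g: "1 \<le> g"
    using M(3) Mb by (simp add: g_def div_greater_zero_iff Suc_le_eq)
  have "b < M * g + M"
    using dividend_less_times_div[of M b] M(3) by (simp add: g_def)
  moreover have "M \<le> M * g"
    using g by simp
  ultimately have "b \<le> 2 * (M * g)"
    by linarith
  then have "real b \<le> real (2 * (M * g))"
    by (simp only: of_nat_le_iff)
  then have bMg: "real b \<le> 2 * real M * real g"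
    by simp
  have L: "l \<le> real L" "real L \<le> 2 * l" "1 \<le> L"
    using l1 by (auto simp: L_def, linarith+)
  have n_powr: "real n = 2 powr l"
    using n by (simp add: l_def)
  also have "\<dots> \<le> 2 powr real L"
    using L(1) by (intro powr_mono) auto
  also have "\<dots> = real (2 ^ L)"
    by (simp add: powr_realpow)
  finally have n2L: "n \<le> 2 ^ L"
    by (simp only: of_nat_le_iff)
  have "l < real n"
    unfolding l_def using n by (intro log2_of_power_less) auto
  then have Ln: "L \<le> n"
    by (simp add: L_def nat_le_iff ceiling_le_iff)
  have K1: "1 \<le> K"
    using L(3) by (simp add: K_def)
  have "n \<le> m * 2 ^ n"
    using less_exp[of n] by (simp add: m_def trans_le_add1 less_imp_le)
  then have I: "n \<le> m * 2 ^ I"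
    unfolding I_def by (rule LeastI)
  have I_min: "I = 0 \<or> m * 2 ^ (I - 1) < n"
    using not_less_Least[of "I - 1" "\<lambda>I. n \<le> m * 2 ^ I"] by (cases "I = 0") (auto simp: I_def)
  have I2n: "2 ^ I \<le> 2 * n"
  proof (cases I)
    case (Suc I')
    have "1 * 2 ^ I' \<le> m * 2 ^ I'"
      by (intro mult_right_mono) (auto simp: m_def)
    moreover have "m * 2 ^ I' < n"
      using I_min Suc by simp
    ultimately have "2 ^ I' < n"
      by linarith
    then show ?thesis
      using Suc by simp
  qed (use n in simp)
  have "real (2 ^ I) \<le> real (2 * n)"
    using I2n by (simp only: of_nat_le_iff)
  then have "2 powr real I \<le> 2 powr (1 + l)"
    by (simp add: powr_add powr_realpow flip: n_powr)
  then have I_le: "real I \<le> 1 + l"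
    by simp
  have "g div K < g"
    using g L(3) by (intro div_less_dividend) (auto simp: K_def)
  moreover have "g \<le> b"
    by (simp add: g_def)
  ultimately have mb: "m \<le> b"
    by (simp add: m_def)
  have bound: "4 * real m * (real I + 1) \<le> 2 ^ (M - 1)"
  proof -
    have "4 * real m * (real I + 1) \<le> 4 * real b * (3 * l)"
      using mb I_le l1 by (intro mult_mono) auto
    also have "\<dots> \<le> 2 powr 5 * (real b * l)"
      using b l1 by simp
    also have "\<dots> = 2 powr (5 + lb)"
      using b l1 by (simp add: powr_add lb_def)
    also have "\<dots> \<le> 2 powr real (M - 1)"
      using M(1) by (intro powr_mono) auto
    also have "\<dots> = 2 ^ (M - 1)"
      by (simp add: powr_realpow)
    finally show ?thesis .
  qed
  obtain f where f: "\<And>i P. i \<le> I \<Longrightarrow> P \<in> patterns n R m i \<Longrightarrow> \<not> silent f b P (R * 2 ^ i)"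
    using ex_array_without_silence[OF n n2L Ln M(3) Mb I2n bound[unfolded m_def K_def g_def]]
    unfolding R_def m_def K_def g_def by blast
  \<comment> \<open>Rounding costs constants only: \<open>K \<le> 1536 * l\<close>, and
    \<open>b \<le> 2 * M * g\<close> with \<open>M \<le> 7 + lb \<le> 4 * lb\<close>. The product
    1536 * 8 is 12288, and the factor 4 from \<open>wake_up_time_le\<close> makes it 49152.\<close>
  have Kg: "real K / real g \<le> 12288 * x"
  proof -
    have "real K * real b \<le> (1536 * l) * (2 * (4 * lb) * real g)"
    proof (intro mult_mono)
      have "2 * real M * real g \<le> 2 * (4 * lb) * real g"
        using M(2) lb3 by (intro mult_right_mono) auto
      then show "real b \<le> 2 * (4 * lb) * real g"
        using bMg by linarith
    qed (use L(2) l1 in \<open>auto simp: K_def\<close>)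
    then show ?thesis
      using g b unfolding x_def l_def[symmetric] lb_def[symmetric] by (simp add: field_simps)
  qed
  have time: "real (R * 2 ^ i) \<le> 49152 * (real k * x + 1)"
    if "1 \<le> k" "i = 0 \<or> m * 2 ^ (i - 1) < k" for i k
  proof -
    have "real (R * 2 ^ i) \<le> 4 * real k * (real K / real g) + 1"
      unfolding R_def using wake_up_time_le[OF g K1 that(1)] that(2) by (simp add: m_def)
    also have "\<dots> \<le> 4 * real k * (12288 * x) + 1"
      using Kg by (intro add_right_mono mult_left_mono) auto
    finally show ?thesis by simp
  qed
  define T :: tarray where "T = (\<lambda>u \<beta> j. f (u, \<beta>, j))"
  have "wakes_within T (R * 2 ^ I) b A \<sigma> (49152 * (real k * x + 1))"
    if A: "A \<subseteq> {1..n}" "A \<noteq> {}" "card A \<le> k" for A k \<sigma>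
  proof -
    obtain i where i: "i = 0 \<or> m * 2 ^ (i - 1) < card A"
      and wakes: "wakes_within T (R * 2 ^ I) b A \<sigma> (real (R * 2 ^ i))"
      using wakes_within_if_not_silent[OF f I A(1,2)] unfolding T_def by blast
    have "finite A"
      using A(1) by (rule finite_subset) simp
    then have "1 \<le> k"
      using A(2,3) by (metis One_nat_def Suc_leI card_gt_0_iff order_trans)
    moreover have "i = 0 \<or> m * 2 ^ (i - 1) < k"
      using i A(3) by linarith
    ultimately have "real (R * 2 ^ i) \<le> 49152 * (real k * x + 1)"
      by (rule time)
    then show ?thesis
      using wakes unfolding wakes_within_def by (meson order_trans)
  qed
  moreover have "real (R * 2 ^ I) \<le> 49152 * (real n * x + 1)"
    using n I_min by (intro time) auto
  ultimately show ?thesis by blast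
qed

text \<open>For \<open>n = 1\<close> the bounds degenerate to constants, because \<open>log 2 1 = 0\<close> and \<open>log 2 0 = 0\<close>.\<close>
lemma wakes_within_singleton:
  assumes "1 \<le> b"
  shows "wakes_within (\<lambda>_ _ _. True) 1 b {u} \<sigma> 1"
proof -
  have "{v \<in> {u}. transmits (\<lambda>_ _ _. True) 1 \<sigma> v 1 (\<sigma> u + 1)} = {u}"
    by (auto simp: transmits_def)
  then have "card {v \<in> {u}. transmits (\<lambda>_ _ _. True) 1 \<sigma> v 1 (\<sigma> u + 1)} = 1"
    by simp
  then show ?thesis
    unfolding wakes_within_def heard_at_def using assms
    by (intro exI[of _ "\<sigma> u + 1"] conjI bexI[of _ 1]) auto
qed

theorem theorem5:
  shows "\<exists>c::real. c > 0 \<and>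
    (\<forall>n b :: nat. 1 \<le> n \<longrightarrow> 1 \<le> b \<longrightarrow>
       real b > log 2 (128 * real b * log 2 (real n)) \<longrightarrow>
       (\<exists>(T::tarray) (ell::nat).
          real ell \<le> c * (real n / real b * log 2 (real n) * log 2 (real b * log 2 (real n)) + 1) \<and>
          (\<forall>(k::nat) (A::nat set) (\<sigma>::nat \<Rightarrow> nat).
             k \<le> n \<longrightarrow> A \<subseteq> {1..n} \<longrightarrow> A \<noteq> {} \<longrightarrow> card A \<le> k \<longrightarrow>
             wakes_within T ell b A \<sigma>
               (c * (real k / real b * log 2 (real n) * log 2 (real b * log 2 (real n)) + 1)))))"
proof (intro exI[of _ "49152::real"] conjI allI impI)
  fix n b :: nat
  assume n: "1 \<le> n" and b: "1 \<le> b" and hyp: "real b > log 2 (128 * real b * log 2 (real n))"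
  show "\<exists>(T::tarray) (ell::nat).
          real ell \<le> 49152 * (real n / real b * log 2 (real n) * log 2 (real b * log 2 (real n)) + 1) \<and>
          (\<forall>(k::nat) (A::nat set) (\<sigma>::nat \<Rightarrow> nat).
             k \<le> n \<longrightarrow> A \<subseteq> {1..n} \<longrightarrow> A \<noteq> {} \<longrightarrow> card A \<le> k \<longrightarrow>
             wakes_within T ell b A \<sigma>
               (49152 * (real k / real b * log 2 (real n) * log 2 (real b * log 2 (real n)) + 1)))"
  proof (cases "n = 1")
    case True
    have "wakes_within (\<lambda>_ _ _. True) 1 b A \<sigma> 49152" if "A \<subseteq> {1..n}" "A \<noteq> {}" for A \<sigma>
    proof -
      have "A = {1}"
        using that True by auto
      then show ?thesis
        using wakes_within_singleton[OF b, of 1 \<sigma>] unfolding wakes_within_def by fastforce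
    qed
    then show ?thesis
      using True by (intro exI[of _ "\<lambda>_ _ _. True"] exI[of _ 1]) auto
  next
    case False
    with n have "2 \<le> n"
      by linarith
    from ex_wake_up_array[OF this b hyp] obtain T ell where
      "real ell \<le> 49152 * (real n * (log 2 (real n) * log 2 (real b * log 2 (real n)) / real b) + 1)"
      "\<And>k A \<sigma>. A \<subseteq> {1..n} \<Longrightarrow> A \<noteq> {} \<Longrightarrow> card A \<le> k \<Longrightarrow> wakes_within T ell b A \<sigma>
         (49152 * (real k * (log 2 (real n) * log 2 (real b * log 2 (real n)) / real b) + 1))"
      by blast
    then show ?thesis
      by (intro exI[of _ T] exI[of _ ell]) (simp add: mult.assoc)
  qed
qed simp

end
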